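(* Let $k$ be a field of characteristic zero, let $B=k[U,V,W]$ be the polynomial ring in three variables, let $D$ be an irreducible, homogeneous and triangularizable locally nilpotent derivation of $B$ of degree $d\geqslant 0$, and let $A=\ker(D)$. Then there is a linear variable $X$ of $B$ with $X\in\ker(D)$ such that for every $n\in\mathbb{N}$ the $n$-th image ideal $I_n=D^nB\cap A$ of $D$ is the principal ideal of $A$ $$I_n=\left(X^{t(d+1)^2+r(d+1)}\right),$$ where $t$ and $r$ are respectively the quotient and the remainder of $n$ when divided by $d+2$.
   Context: Let $k$ be a field of characteristic zero and $B=k[U,V,W]$. A locally nilpotent derivation (LND) of $B$ is a $k$-derivation $D:B\to B$ such that for each $b\in B$ there is $n$ with $D^n b=0$. Homogeneous and degree: $B$ has the standard grading $\deg U=\deg V=\deg W=1$, $B=\bigoplus_i B_i$. A nonzero $D$ is homogeneous of degree $d\in\mathbb{Z}$ if $D(B_i)\subseteq B_{i+d}$ for all $i$. Irreducible: the ideal of $B$ generated by $D(B)$ is not contained in any proper principal ideal of $B$. Triangularizable: there is a coordinate system $\{X_1,X_2,X_3\}$ of $B$ (i.e. $B=k[X_1,X_2,X_3]$) with $DX_1\in k$, $DX_2\in k[X_1]$ and $DX_3\in k[X_1,X_2]$. A linear variable of $B$ is a nonzero homogeneous linear form in $U,V,W$. For $n\ge 0$, the $n$-th image ideal of $D$ is $I_n=D^n(B)\cap A$, an ideal of $A=\ker(D)$. *)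

theory Defs
  imports Complex_Main "HOL-Library.Poly_Mapping" "HOL-Library.Numeral_Type"
begin

text \<open>
  The polynomial ring \<open>k[U,V,W]\<close> as finitely supported maps from exponent vectors to
  coefficients. The three variables are indexed by the type \<open>3\<close>, whose elements are
  \<open>1\<close>, \<open>2\<close> and \<open>3\<close> (arithmetic is modulo three, so \<open>3 = 0\<close> there).
\<close>

type_synonym 'k poly3 = "(3 \<Rightarrow>\<^sub>0 nat) \<Rightarrow>\<^sub>0 'k"

definition const :: "'k::zero \<Rightarrow> 'k poly3" where
  "const c = Poly_Mapping.single 0 c"

definition total_degree :: "(3 \<Rightarrow>\<^sub>0 nat) \<Rightarrow> nat" where
  "total_degree m = (\<Sum>i\<in>UNIV. Poly_Mapping.lookup m i)"

text \<open>The grading is indexed by the integers; the components of negative degree are zero.\<close>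

definition homogeneous_component :: "int \<Rightarrow> 'k::zero poly3 set" where
  "homogeneous_component i = {p. \<forall>m\<in>Poly_Mapping.keys p. int (total_degree m) = i}"

definition linear_variable :: "'k::zero poly3 \<Rightarrow> bool" where
  "linear_variable X \<longleftrightarrow> X \<noteq> 0 \<and> X \<in> homogeneous_component 1"


definition is_ideal :: "'r::comm_ring_1 set \<Rightarrow> bool" where
  "is_ideal I \<longleftrightarrow> 0 \<in> I \<and> (\<forall>a\<in>I. \<forall>b\<in>I. a + b \<in> I) \<and> (\<forall>r. \<forall>a\<in>I. r * a \<in> I)"

text \<open>The principal ideal generated by \<open>x\<close> in the subring \<open>A\<close> (which should contain \<open>x\<close>).\<close>

definition principal_ideal :: "'r::comm_ring_1 set \<Rightarrow> 'r \<Rightarrow> 'r set" where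
  "principal_ideal A x = {a * x | a. a \<in> A}"

definition is_subalgebra :: "'k::comm_ring_1 poly3 set \<Rightarrow> bool" where
  "is_subalgebra S \<longleftrightarrow> range const \<subseteq> S
     \<and> (\<forall>p\<in>S. \<forall>q\<in>S. p + q \<in> S) \<and> (\<forall>p\<in>S. \<forall>q\<in>S. p * q \<in> S)"

text \<open>\<open>adjoin S\<close> is \<open>k[S]\<close>.\<close>

definition adjoin :: "'k::comm_ring_1 poly3 set \<Rightarrow> 'k poly3 set" where
  "adjoin S = is_subalgebra hull S"

definition subst :: "(3 \<Rightarrow> 'k::comm_ring_1 poly3) \<Rightarrow> 'k poly3 \<Rightarrow> 'k poly3" where
  "subst X p = (\<Sum>m\<in>Poly_Mapping.keys p.
     const (Poly_Mapping.lookup p m) * (\<Prod>i\<in>UNIV. X i ^ Poly_Mapping.lookup m i))"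

text \<open>
  \<open>B = k[X\<^sub>1,X\<^sub>2,X\<^sub>3]\<close> as a polynomial ring: the \<open>X\<^sub>i\<close> generate \<open>B\<close> and are algebraically
  independent (the latter being injectivity of the evaluation homomorphism at the \<open>X\<^sub>i\<close>).
\<close>

definition coordinate_system :: "(3 \<Rightarrow> 'k::comm_ring_1 poly3) \<Rightarrow> bool" where
  "coordinate_system X \<longleftrightarrow> adjoin (range X) = UNIV \<and> inj (subst X)"


definition derivation :: "('k::comm_ring_1 poly3 \<Rightarrow> 'k poly3) \<Rightarrow> bool" where
  "derivation D \<longleftrightarrow>
     (\<forall>p q. D (p + q) = D p + D q) \<and>
     (\<forall>c p. D (const c * p) = const c * D p) \<and>
     (\<forall>p q. D (p * q) = D p * q + p * D q)"

definition locally_nilpotent_derivation :: "('k::comm_ring_1 poly3 \<Rightarrow> 'k poly3) \<Rightarrow> bool" where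
  "locally_nilpotent_derivation D \<longleftrightarrow> derivation D \<and> (\<forall>b. \<exists>n. (D ^^ n) b = 0)"

definition homogeneous_derivation :: "('k::comm_ring_1 poly3 \<Rightarrow> 'k poly3) \<Rightarrow> int \<Rightarrow> bool" where
  "homogeneous_derivation D d \<longleftrightarrow>
     (\<exists>b. D b \<noteq> 0) \<and>
     (\<forall>i. D ` homogeneous_component i \<subseteq> homogeneous_component (i + d))"

definition irreducible_derivation :: "('k::comm_ring_1 poly3 \<Rightarrow> 'k poly3) \<Rightarrow> bool" where
  "irreducible_derivation D \<longleftrightarrow>
     \<not> (\<exists>b. principal_ideal UNIV b \<noteq> UNIV \<and> is_ideal hull (range D) \<subseteq> principal_ideal UNIV b)"

definition triangularizable :: "('k::comm_ring_1 poly3 \<Rightarrow> 'k poly3) \<Rightarrow> bool" where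
  "triangularizable D \<longleftrightarrow>
     (\<exists>X. coordinate_system X \<and>
        D (X 1) \<in> range const \<and>
        D (X 2) \<in> adjoin {X 1} \<and>
        D (X 3) \<in> adjoin {X 1, X 2})"

definition derivation_kernel :: "('k::comm_ring_1 poly3 \<Rightarrow> 'k poly3) \<Rightarrow> 'k poly3 set" where
  "derivation_kernel D = {b. D b = 0}"

definition image_ideal :: "('k::comm_ring_1 poly3 \<Rightarrow> 'k poly3) \<Rightarrow> nat \<Rightarrow> 'k poly3 set" where
  "image_ideal D n = range (D ^^ n) \<inter> derivation_kernel D"

end

theory Submission
  imports Defs "HOL-Analysis.Cartesian_Space"
begin

text \<open>
  A homogeneous derivation shifts the order filtration, so triangular coordinates may be replaced by
  their linear parts \<open>X, Y, Z\<close>: with \<open>e = d + 1\<close> this gives \<open>D X = 0\<close>, \<open>D Y = a X\<^sup>e\<close> and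
  \<open>D Z = c\<^sub>e Y\<^sup>e + X h(X, Y)\<close>, where irreducibility forces \<open>X\<close>, \<open>a\<close> and \<open>c\<^sub>e\<close> to be nonzero.
  The kernel element \<open>X\<^sup>e Z - F(X, Y)\<close>, with \<open>\<partial>F/\<partial>Y\<close> equal to \<open>D Z / a\<close>, shows that \<open>B\<close> is
  spanned over \<open>A\<close> by the \<open>E\<^sub>n = Z\<^sup>t Y\<^sup>r\<close> with \<open>n = t (e + 1) + r\<close> and \<open>r \<le> e\<close>. Since \<open>D\<^sup>n E\<^sub>n\<close> is a nonzero
  scalar multiple of \<open>X\<close> to the power \<open>t e\<^sup>2 + r e\<close>, the \<open>E\<^sub>n\<close> have pairwise distinct nilpotency
  degrees, and \<open>D\<^sup>n b \<in> A\<close> forces \<open>b\<close> to involve only \<open>E\<^sub>0, \<dots>, E\<^sub>n\<close>.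
\<close>

section \<open>Polynomials, subalgebras and substitution\<close>

lemma const_0 [simp]: "const 0 = 0"
  by (simp add: const_def)

lemma const_1 [simp]: "const 1 = (1 :: 'k::comm_ring_1 poly3)"
  by (simp add: const_def)

lemma const_add: "const (a + b) = const a + (const b :: 'k::comm_ring_1 poly3)"
  by (simp add: const_def single_add)

lemma const_mult: "const (a * b) = const a * (const b :: 'k::comm_ring_1 poly3)"
  by (simp add: const_def mult_single)

lemma const_sum: "const (sum f I) = (\<Sum>i\<in>I. const (f i) :: 'k::comm_ring_1 poly3)"
  by (induction I rule: infinite_finite_induct) (auto simp: const_add)

lemma const_of_nat: "const (of_nat n) = (of_nat n :: 'k::comm_ring_1 poly3)"
  by (simp add: const_def)

lemma const_uminus: "const (- a) = - (const a :: 'k::comm_ring_1 poly3)"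
  by (simp add: const_def single_uminus)

lemma lookup_const: "Poly_Mapping.lookup (const c) m = (c when m = 0)"
  by (auto simp: const_def lookup_single when_def)

lemma const_eq_0_iff [simp]: "const c = (0 :: 'k::comm_ring_1 poly3) \<longleftrightarrow> c = 0"
  using lookup_const[of c 0] by auto

text \<open>Restricting the support gives the two summands; with \<open>M\<close> the monomials of a
  fixed total degree this cuts out a homogeneous part.\<close>

lemma keys_split:
  fixes p :: "'a \<Rightarrow>\<^sub>0 'b::comm_monoid_add"
  obtains q r where "p = q + r" "Poly_Mapping.keys q = Poly_Mapping.keys p \<inter> M"
    "Poly_Mapping.keys r = Poly_Mapping.keys p - M"
proof -
  define part where "part S = (\<Sum>m\<in>S. Poly_Mapping.single m (Poly_Mapping.lookup p m))" for S
  have lk: "Poly_Mapping.lookup (part S) k = (Poly_Mapping.lookup p k when k \<in> S)"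
    if "finite S" for S k
    using that by (simp add: part_def lookup_sum lookup_single when_def)
  show thesis
  proof
    show "p = part (Poly_Mapping.keys p \<inter> M) + part (Poly_Mapping.keys p - M)"
      by (rule poly_mapping_eqI) (auto simp: lookup_add lk when_def in_keys_iff)
  qed (auto simp: lk in_keys_iff when_def split: if_splits)
qed

lemma poly_mapping_sum_single:
  "p = (\<Sum>m\<in>Poly_Mapping.keys p. Poly_Mapping.single m (Poly_Mapping.lookup p m))"
  by (rule poly_mapping_eqI) (simp add: lookup_sum lookup_single when_def in_keys_iff)

lemma poly_mapping_single_add_induct [case_names single add]:
  fixes p :: "'a \<Rightarrow>\<^sub>0 'b::comm_monoid_add"
  assumes single: "\<And>m c. P (Poly_Mapping.single m c)"
    and add: "\<And>p q. P p \<Longrightarrow> P q \<Longrightarrow> P (p + q)"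
  shows "P p"
proof -
  have "P (\<Sum>m\<in>S. Poly_Mapping.single m (Poly_Mapping.lookup p m))" for S
  proof (induction S rule: infinite_finite_induct)
    case (insert x F)
    then show ?case using single add by simp
  qed (use single[of undefined 0] in auto)
  then show ?thesis
    using poly_mapping_sum_single[of p] by metis
qed

lemma keys_mult_subset:
  assumes "Poly_Mapping.keys p \<subseteq> S" "Poly_Mapping.keys q \<subseteq> T"
    and "\<And>a b. a \<in> S \<Longrightarrow> b \<in> T \<Longrightarrow> a + b \<in> R"
  shows "Poly_Mapping.keys (p * q) \<subseteq> R"
  using keys_mult[of p q] assms by blast

section \<open>Generated subalgebras\<close>

lemma is_subalgebra_adjoin: "is_subalgebra (adjoin S)"
  unfolding adjoin_def by (rule hull_in) (fastforce simp: is_subalgebra_def)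

lemma adjoin_subsetI: "S \<subseteq> T \<Longrightarrow> is_subalgebra T \<Longrightarrow> adjoin S \<subseteq> T"
  unfolding adjoin_def by (rule hull_minimal)

lemma adjoin_superset: "S \<subseteq> adjoin S"
  unfolding adjoin_def by (rule hull_subset)

lemma is_subalgebraD:
  assumes "is_subalgebra S"
  shows "const c \<in> S" and "0 \<in> S" and "1 \<in> S"
    and "p \<in> S \<Longrightarrow> q \<in> S \<Longrightarrow> p + q \<in> S" and "p \<in> S \<Longrightarrow> q \<in> S \<Longrightarrow> p * q \<in> S"
proof -
  show c: "const c \<in> S" for c
    using assms by (auto simp: is_subalgebra_def)
  show "0 \<in> S" "1 \<in> S"
    using c[of 0] c[of 1] by simp_all
qed (use assms in \<open>auto simp: is_subalgebra_def\<close>)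

lemma is_subalgebra_power: "is_subalgebra S \<Longrightarrow> p \<in> S \<Longrightarrow> p ^ n \<in> S"
  by (induction n) (auto simp: is_subalgebraD)

lemma is_subalgebra_sum: "is_subalgebra S \<Longrightarrow> (\<And>i. i \<in> I \<Longrightarrow> f i \<in> S) \<Longrightarrow> sum f I \<in> S"
  by (induction I rule: infinite_finite_induct) (auto simp: is_subalgebraD)

lemma is_subalgebra_prod: "is_subalgebra S \<Longrightarrow> (\<And>i. i \<in> I \<Longrightarrow> f i \<in> S) \<Longrightarrow> prod f I \<in> S"
  by (induction I rule: infinite_finite_induct) (auto simp: is_subalgebraD)

section \<open>Substitution as an algebra homomorphism\<close>

lemma subst_in_subalgebra:
  assumes "is_subalgebra S" "range X \<subseteq> S"
  shows "subst X p \<in> S"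
  unfolding subst_def using assms
  by (intro is_subalgebra_sum is_subalgebraD is_subalgebra_prod is_subalgebra_power) auto

lemma subst_single:
  "subst X (Poly_Mapping.single m c) = const c * (\<Prod>i\<in>UNIV. X i ^ Poly_Mapping.lookup m i)"
  by (simp add: subst_def)

lemma subst_add: "subst X (p + q) = subst X p + subst X q"
proof -
  \<comment> \<open>Monomials outside the support contribute zero, so \<open>p\<close>,
    \<open>q\<close> and \<open>p + q\<close> can all be summed over one common finite set.\<close>
  have superset: "subst X r = (\<Sum>m\<in>S. const (Poly_Mapping.lookup r m) *
      (\<Prod>i\<in>UNIV. X i ^ Poly_Mapping.lookup m i))"
    if "finite S" "Poly_Mapping.keys r \<subseteq> S" for r S
    unfolding subst_def using that by (intro sum.mono_neutral_left) (auto simp: in_keys_iff)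
  let ?S = "Poly_Mapping.keys p \<union> Poly_Mapping.keys q"
  show ?thesis
    using keys_add[of p q]
    by (simp add: superset[of ?S] lookup_add const_add ring_distribs sum.distrib)
qed

lemma subst_0 [simp]: "subst X 0 = 0"
  by (simp add: subst_def)

lemma subst_const [simp]: "subst X (const c) = const c"
  unfolding const_def subst_single by (simp add: const_def)

lemma subst_uminus: "subst X (- p) = - subst X p"
  using subst_add[of X p "- p"] by (simp add: eq_neg_iff_add_eq_0 add.commute)

lemma subst_diff: "subst X (p - q) = subst X p - subst X q"
  using subst_add[of X p "- q"] by (simp add: subst_uminus)

lemma subst_mult: "subst X (p * q) = subst X p * subst X q"
proof (induction p rule: poly_mapping_single_add_induct)
  case (single m c)
  show ?case
  proof (induction q rule: poly_mapping_single_add_induct)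
    case (single m' c')
    show ?case
      by (simp add: mult_single subst_single const_mult lookup_add power_add prod.distrib mult_ac)
  next
    case (add p q)
    then show ?case by (simp add: ring_distribs subst_add)
  qed
next
  case (add p q)
  then show ?case by (simp add: ring_distribs subst_add)
qed

lemma subst_power: "subst X (p ^ n) = subst X p ^ n"
  using subst_const[of X 1] by (induction n) (simp_all add: subst_mult)

lemma subst_prod: "subst X (prod f I) = (\<Prod>i\<in>I. subst X (f i))"
  using subst_const[of X 1]
  by (induction I rule: infinite_finite_induct) (simp_all add: subst_mult)

lemma subst_subst: "subst X (subst G p) = subst (\<lambda>i. subst X (G i)) p"
  by (induction p rule: poly_mapping_single_add_induct)
    (simp_all add: subst_single subst_add subst_mult subst_power subst_prod)

definition var :: "3 \<Rightarrow> 'k::comm_ring_1 poly3" where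
  "var i = Poly_Mapping.single (Poly_Mapping.single i 1) 1"

lemma subst_var [simp]: "subst var p = p"
proof (induction p rule: poly_mapping_single_add_induct)
  case (single m c)
  have pow: "(var i :: 'a poly3) ^ n = Poly_Mapping.single (Poly_Mapping.single i n) 1" for i n
  proof (induction n)
    case (Suc n)
    then show ?case
      by (simp add: var_def mult_single single_add[symmetric])
  qed simp
  have "(\<Prod>i\<in>I. Poly_Mapping.single (g i) (1 :: 'a)) = Poly_Mapping.single (\<Sum>i\<in>I. g i) 1"
    for I and g :: "3 \<Rightarrow> (3 \<Rightarrow>\<^sub>0 nat)"
    by (induction I rule: infinite_finite_induct) (simp_all add: mult_single)
  moreover have "(\<Sum>i\<in>UNIV. Poly_Mapping.single i (Poly_Mapping.lookup m i)) = m"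
    by (rule poly_mapping_eqI) (simp add: lookup_sum lookup_single when_def)
  ultimately show ?case
    by (simp add: subst_single pow const_def mult_single)
qed (simp add: subst_add)

lemma subst_var_eq [simp]: "subst X (var i) = X i"
proof -
  have "(\<Prod>j\<in>UNIV. X j ^ Poly_Mapping.lookup (Poly_Mapping.single i 1) j)
      = (\<Prod>j\<in>UNIV. if j = i then X j else 1)"
    by (intro prod.cong) (auto simp: lookup_single when_def)
  then show ?thesis
    by (simp add: var_def subst_single)
qed

lemma is_subalgebra_subst_image:
  fixes S :: "'k::comm_ring_1 poly3 set"
  assumes S: "is_subalgebra S"
  shows "is_subalgebra (subst X ` S)"
  unfolding is_subalgebra_def
proof (intro conjI ballI subsetI)
  fix y :: "'k poly3"
  assume "y \<in> range const"
  then obtain c where "y = subst X (const c)" by auto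
  then show "y \<in> subst X ` S" using is_subalgebraD(1)[OF S] by blast
next
  fix s t assume "s \<in> subst X ` S" "t \<in> subst X ` S"
  then obtain p q where pq: "p \<in> S" "q \<in> S" "s = subst X p" "t = subst X q" by blast
  show "s + t \<in> subst X ` S" "s * t \<in> subst X ` S"
    unfolding pq(3,4) subst_add[symmetric] subst_mult[symmetric]
    using pq(1,2) is_subalgebraD(4,5)[OF S] by (auto intro: imageI)
qed

lemma adjoin_subset_subst:
  "adjoin (X ` I) \<subseteq> subst X ` {p. \<forall>m\<in>Poly_Mapping.keys p. \<forall>i. i \<notin> I \<longrightarrow> Poly_Mapping.lookup m i = 0}"
    (is "_ \<subseteq> subst X ` ?P")
proof (intro adjoin_subsetI is_subalgebra_subst_image)
  have "var i \<in> ?P" if "i \<in> I" for i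
    using that by (auto simp: var_def lookup_single when_def split: if_splits)
  then show "X ` I \<subseteq> subst X ` ?P"
    by (intro image_subsetI rev_image_eqI[of "var _"]) auto
  show "is_subalgebra ?P"
    unfolding is_subalgebra_def
  proof (intro conjI ballI)
    show "range const \<subseteq> ?P"
      by (auto simp: const_def split: if_splits)
  next
    fix p q assume "p \<in> ?P" "q \<in> ?P"
    then show "p + q \<in> ?P"
      using keys_add[of p q] by blast
  next
    fix p q assume pq: "p \<in> ?P" "q \<in> ?P"
    let ?M = "{m. \<forall>i. i \<notin> I \<longrightarrow> Poly_Mapping.lookup m i = 0}"
    have "Poly_Mapping.keys (p * q) \<subseteq> ?M"
      using pq by (intro keys_mult_subset[of p ?M q ?M]) (auto simp: lookup_add)
    then show "p * q \<in> ?P" by blast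
  qed
qed

section \<open>The order filtration\<close>

text \<open>Over a commutative ring this is the \<open>j\<close>-th power of the ideal generated by
  the variables.\<close>

definition order_ge :: "nat \<Rightarrow> 'k::zero poly3 set" where
  "order_ge j = {p. \<forall>m\<in>Poly_Mapping.keys p. j \<le> total_degree m}"

lemma total_degree_add: "total_degree (m + m') = total_degree m + total_degree m'"
  by (simp add: total_degree_def lookup_add sum.distrib)

lemma total_degree_eq_0_iff: "total_degree m = 0 \<longleftrightarrow> m = 0"
  by (auto simp: total_degree_def intro: poly_mapping_eqI)

lemma order_ge_0 [simp]: "p \<in> order_ge 0"
  by (simp add: order_ge_def)

lemma zero_in_order_ge [simp]: "0 \<in> order_ge j"
  by (simp add: order_ge_def)

lemma order_ge_mono: "p \<in> order_ge j \<Longrightarrow> i \<le> j \<Longrightarrow> p \<in> order_ge i"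
  by (auto simp: order_ge_def)

lemma order_ge_1_iff: "p \<in> order_ge 1 \<longleftrightarrow> Poly_Mapping.lookup p 0 = 0"
proof -
  have "p \<in> order_ge 1 \<longleftrightarrow> (\<forall>m\<in>Poly_Mapping.keys p. m \<noteq> 0)"
    unfolding order_ge_def by (simp add: Suc_le_eq total_degree_eq_0_iff flip: neq0_conv)
  also have "\<dots> \<longleftrightarrow> 0 \<notin> Poly_Mapping.keys p" by metis
  finally show ?thesis by (simp add: in_keys_iff)
qed

lemma order_ge_add: "p \<in> order_ge j \<Longrightarrow> q \<in> order_ge j \<Longrightarrow> p + q \<in> order_ge j"
  using keys_add[of p q] unfolding order_ge_def by blast

lemma order_ge_uminus: "p \<in> order_ge j \<Longrightarrow> - p \<in> order_ge j"
  for p :: "'k::comm_ring_1 poly3"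
  by (auto simp: order_ge_def in_keys_iff)

lemma order_ge_diff: "p \<in> order_ge j \<Longrightarrow> q \<in> order_ge j \<Longrightarrow> p - q \<in> order_ge j"
  for p q :: "'k::comm_ring_1 poly3"
  using order_ge_add[of p j "- q"] order_ge_uminus[of q j] by simp

lemma order_ge_sum: "(\<And>i. i \<in> I \<Longrightarrow> f i \<in> order_ge j) \<Longrightarrow> sum f I \<in> order_ge j"
  by (induction I rule: infinite_finite_induct) (auto intro: order_ge_add)

lemma order_ge_mult: "p \<in> order_ge i \<Longrightarrow> q \<in> order_ge j \<Longrightarrow> p * q \<in> order_ge (i + j)"
  using keys_mult_subset[of p "{m. i \<le> total_degree m}" q "{m. j \<le> total_degree m}"
      "{m. i + j \<le> total_degree m}"]
  by (auto simp: order_ge_def total_degree_add)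

lemma order_ge_mult_left: "q \<in> order_ge j \<Longrightarrow> p * q \<in> order_ge j"
  using order_ge_mult[of p 0 q j] by simp

lemma order_ge_prod:
  "(\<And>i. i \<in> I \<Longrightarrow> f i \<in> order_ge (n i)) \<Longrightarrow> prod f I \<in> order_ge (sum n I)"
  by (induction I rule: infinite_finite_induct) (auto intro: order_ge_mult)

lemma order_ge_power: "p \<in> order_ge j \<Longrightarrow> p ^ n \<in> order_ge (n * j)"
  for p :: "'k::comm_ring_1 poly3"
  using order_ge_prod[of "{..<n}" "\<lambda>_. p" "\<lambda>_. j"] by simp

text \<open>Telescoping: \<open>f F - g G = f (F - G) + (f - g) G\<close>, where each summand
  contains one difference and so gains one order.\<close>

lemma order_ge_prod_diff:
  fixes f g :: "'i \<Rightarrow> 'k::comm_ring_1 poly3"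
  assumes "finite I" "\<And>i. i \<in> I \<Longrightarrow> f i \<in> order_ge (n i)" "\<And>i. i \<in> I \<Longrightarrow> g i \<in> order_ge (n i)"
    "\<And>i. i \<in> I \<Longrightarrow> f i - g i \<in> order_ge (Suc (n i))"
  shows "prod f I - prod g I \<in> order_ge (Suc (sum n I))"
  using assms
proof (induction I rule: finite_induct)
  case (insert i I)
  have "f i * (prod f I - prod g I) + (f i - g i) * prod g I \<in> order_ge (Suc (n i + sum n I))"
    using insert order_ge_mult[of "f i" "n i" "prod f I - prod g I" "Suc (sum n I)"]
      order_ge_mult[of "f i - g i" "Suc (n i)" "prod g I" "sum n I"] order_ge_prod[of I g n]
    by (intro order_ge_add) auto
  then show ?case
    using insert.hyps by (simp add: algebra_simps)
qed simp

lemma order_ge_power_diff: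
  fixes p q :: "'k::comm_ring_1 poly3"
  assumes "p \<in> order_ge 1" "q \<in> order_ge 1" "p - q \<in> order_ge 2"
  shows "p ^ n - q ^ n \<in> order_ge (Suc n)"
  using order_ge_prod_diff[of "{..<n}" "\<lambda>_. p" "\<lambda>_. 1" "\<lambda>_. q"] assms
  by (simp add: numeral_2_eq_2)

section \<open>Homogeneous components and lowest-degree parts\<close>

lemma homogeneous_component_nat:
  "p \<in> homogeneous_component (int j) \<longleftrightarrow> (\<forall>m\<in>Poly_Mapping.keys p. total_degree m = j)"
  by (simp add: homogeneous_component_def)

lemma homogeneous_in_order_ge: "p \<in> homogeneous_component (int j) \<Longrightarrow> p \<in> order_ge j"
  by (simp add: homogeneous_component_nat order_ge_def)

text \<open>No monomial can satisfy both degree conditions. This upgrades congruences modulo higher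
  order to equalities between homogeneous elements.\<close>

lemma homogeneous_order_ge_Suc_eq_0:
  assumes "p \<in> homogeneous_component (int j)" "p \<in> order_ge (Suc j)"
  shows "p = 0"
proof -
  have "Poly_Mapping.keys p = {}"
    using assms by (force simp: homogeneous_component_nat order_ge_def)
  then show ?thesis
    by (metis in_keys_iff empty_iff lookup_zero poly_mapping_eqI)
qed

lemma homogeneous_zero [simp]: "0 \<in> homogeneous_component i"
  by (simp add: homogeneous_component_def)

lemma homogeneous_const: "const c \<in> homogeneous_component 0"
  by (simp add: homogeneous_component_def const_def total_degree_def)

lemma homogeneous_add:
  "p \<in> homogeneous_component i \<Longrightarrow> q \<in> homogeneous_component i \<Longrightarrow> p + q \<in> homogeneous_component i"
  using keys_add[of p q] unfolding homogeneous_component_def by blast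

lemma homogeneous_diff:
  "p \<in> homogeneous_component i \<Longrightarrow> q \<in> homogeneous_component i \<Longrightarrow> p - q \<in> homogeneous_component i"
  for p q :: "'k::comm_ring_1 poly3"
  using homogeneous_add[of p i "- q"] by (simp add: homogeneous_component_def in_keys_iff)

lemma homogeneous_sum:
  "(\<And>i. i \<in> I \<Longrightarrow> f i \<in> homogeneous_component j) \<Longrightarrow> sum f I \<in> homogeneous_component j"
  by (induction I rule: infinite_finite_induct) (auto intro: homogeneous_add)

lemma homogeneous_mult:
  "p \<in> homogeneous_component i \<Longrightarrow> q \<in> homogeneous_component j \<Longrightarrow> p * q \<in> homogeneous_component (i + j)"
  using keys_mult_subset[of p "{m. int (total_degree m) = i}" q "{m. int (total_degree m) = j}"
      "{m. int (total_degree m) = i + j}"]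
  by (auto simp: homogeneous_component_def total_degree_add)

lemma homogeneous_prod:
  fixes f :: "'i \<Rightarrow> 'k::comm_ring_1 poly3"
  shows "(\<And>i. i \<in> I \<Longrightarrow> f i \<in> homogeneous_component (n i)) \<Longrightarrow> prod f I \<in> homogeneous_component (sum n I)"
  using homogeneous_const[of "1::'k"]
  by (induction I rule: infinite_finite_induct) (auto intro: homogeneous_mult)

lemma homogeneous_power:
  "p \<in> homogeneous_component j \<Longrightarrow> p ^ n \<in> homogeneous_component (int n * j)"
  for p :: "'k::comm_ring_1 poly3"
  using homogeneous_prod[of "{..<n}" "\<lambda>_. p" "\<lambda>_. j"] by simp

text \<open>\<open>q\<close> is the part of degree exactly \<open>j\<close>. The inclusion of
  supports records that no new variables appear, which later preserves triangularity.\<close>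

lemma order_ge_split:
  fixes p :: "'k::comm_ring_1 poly3"
  assumes "p \<in> order_ge j"
  obtains q where "q \<in> homogeneous_component (int j)" "p - q \<in> order_ge (Suc j)"
    "Poly_Mapping.keys q \<subseteq> Poly_Mapping.keys p"
proof -
  obtain q r where "p = q + r" "Poly_Mapping.keys q = Poly_Mapping.keys p \<inter> {m. total_degree m = j}"
    "Poly_Mapping.keys r = Poly_Mapping.keys p - {m. total_degree m = j}"
    by (rule keys_split)
  moreover from this have "p - q = r" by simp
  ultimately show thesis
    using assms by (intro that[of q]) (auto simp: order_ge_def homogeneous_component_def)
qed

lemma var_homogeneous: "var i \<in> homogeneous_component 1"
  by (simp add: homogeneous_component_def var_def total_degree_def lookup_single when_def flip: of_nat_sum)

lemma var_order_ge: "var i \<in> order_ge 1"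
  using var_homogeneous[of i] by (intro homogeneous_in_order_ge) simp

lemma subst_order_ge:
  assumes "\<And>i. X i \<in> order_ge 1" "p \<in> order_ge j"
  shows "subst X p \<in> order_ge j"
  unfolding subst_def
proof (intro order_ge_sum order_ge_mult_left)
  fix m assume "m \<in> Poly_Mapping.keys p"
  then have "j \<le> (\<Sum>i\<in>UNIV. Poly_Mapping.lookup m i)"
    using assms(2) by (simp add: order_ge_def total_degree_def)
  moreover have "(\<Prod>i\<in>UNIV. X i ^ Poly_Mapping.lookup m i) \<in> order_ge (\<Sum>i\<in>UNIV. Poly_Mapping.lookup m i)"
    using order_ge_power[OF assms(1)] by (intro order_ge_prod) fastforce
  ultimately show "(\<Prod>i\<in>UNIV. X i ^ Poly_Mapping.lookup m i) \<in> order_ge j"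
    using order_ge_mono by blast
qed

lemma subst_homogeneous:
  assumes "\<And>i. L i \<in> homogeneous_component 1" "p \<in> homogeneous_component j"
  shows "subst L p \<in> homogeneous_component j"
  unfolding subst_def
proof (intro homogeneous_sum)
  fix m assume "m \<in> Poly_Mapping.keys p"
  then have "j = (\<Sum>i\<in>UNIV. int (Poly_Mapping.lookup m i))"
    using assms(2) by (simp add: homogeneous_component_def total_degree_def)
  moreover have "(\<Prod>i\<in>UNIV. L i ^ Poly_Mapping.lookup m i)
      \<in> homogeneous_component (\<Sum>i\<in>UNIV. int (Poly_Mapping.lookup m i))"
    using homogeneous_power[OF assms(1)] by (intro homogeneous_prod) fastforce
  ultimately show "const (Poly_Mapping.lookup p m) * (\<Prod>i\<in>UNIV. L i ^ Poly_Mapping.lookup m i)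
      \<in> homogeneous_component j"
    using homogeneous_mult[OF homogeneous_const] by fastforce
qed

text \<open>Replacing coordinates by their linear parts disturbs each monomial only in higher order,
  by \<open>order_ge_prod_diff\<close>.\<close>

lemma subst_diff_order_ge:
  assumes X: "\<And>i. X i \<in> order_ge 1" and L: "\<And>i. L i \<in> order_ge 1"
    and XL: "\<And>i. X i - L i \<in> order_ge 2" and p: "p \<in> order_ge j"
  shows "subst X p - subst L p \<in> order_ge (Suc j)"
  unfolding subst_def sum_subtractf[symmetric] right_diff_distrib[symmetric]
proof (intro order_ge_sum order_ge_mult_left)
  fix m assume "m \<in> Poly_Mapping.keys p"
  then have "j \<le> (\<Sum>i\<in>UNIV. Poly_Mapping.lookup m i)"
    using p by (simp add: order_ge_def total_degree_def)
  moreover have "(\<Prod>i\<in>UNIV. X i ^ Poly_Mapping.lookup m i) - (\<Prod>i\<in>UNIV. L i ^ Poly_Mapping.lookup m i)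
      \<in> order_ge (Suc (\<Sum>i\<in>UNIV. Poly_Mapping.lookup m i))"
    using order_ge_power[OF X] order_ge_power[OF L] order_ge_power_diff[OF X L XL]
    by (intro order_ge_prod_diff) fastforce+
  ultimately show "(\<Prod>i\<in>UNIV. X i ^ Poly_Mapping.lookup m i)
      - (\<Prod>i\<in>UNIV. L i ^ Poly_Mapping.lookup m i) \<in> order_ge (Suc j)"
    using order_ge_mono by (meson Suc_le_mono)
qed

section \<open>Derivations\<close>

context
  fixes D :: "'k::comm_ring_1 poly3 \<Rightarrow> 'k poly3"
  assumes D: "derivation D"
begin

lemma derivation_add: "D (p + q) = D p + D q"
  and derivation_const_mult: "D (const c * p) = const c * D p"
  and derivation_mult: "D (p * q) = D p * q + p * D q"
  using D by (auto simp: derivation_def)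

lemma derivation_0: "D 0 = 0"
  using derivation_add[of 0 0] by simp

lemma derivation_const: "D (const c) = 0"
  using derivation_const_mult[of c 1] derivation_mult[of 1 1] by simp

lemma derivation_diff: "D (p - q) = D p - D q"
  using derivation_add[of "p - q" q] by simp

lemma derivation_sum: "D (sum f I) = (\<Sum>i\<in>I. D (f i))"
  by (induction I rule: infinite_finite_induct) (auto simp: derivation_0 derivation_add)

lemma derivation_power: "D (p ^ n) = of_nat n * p ^ (n - 1) * D p"
proof (induction n)
  case 0
  show ?case using derivation_const[of 1] by simp
next
  case (Suc n)
  then show ?case
    by (cases n) (simp_all add: derivation_mult algebra_simps)
qed

lemma derivation_kernel_mult: "D a = 0 \<Longrightarrow> D (a * b) = a * D b"
  by (simp add: derivation_mult)

lemma funpow_derivation_add: "(D ^^ n) (p + q) = (D ^^ n) p + (D ^^ n) q"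
  by (induction n) (auto simp: derivation_add)

lemma funpow_derivation_0: "(D ^^ n) 0 = 0"
  by (induction n) (auto simp: derivation_0)

lemma funpow_derivation_sum: "(D ^^ n) (sum f I) = (\<Sum>i\<in>I. (D ^^ n) (f i))"
  by (induction n) (auto simp: derivation_sum)

lemma funpow_derivation_kernel_mult: "D a = 0 \<Longrightarrow> (D ^^ n) (a * b) = a * (D ^^ n) b"
  by (induction n) (auto simp: derivation_kernel_mult)

lemma funpow_derivation_eq_0_mono:
  assumes "(D ^^ n) p = 0" "n \<le> m"
  shows "(D ^^ m) p = 0"
proof -
  have "(D ^^ m) p = (D ^^ (m - n)) ((D ^^ n) p)"
    using assms(2) by (metis comp_apply funpow_add le_add_diff_inverse2)
  then show ?thesis
    using assms(1) by (simp add: funpow_derivation_0)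
qed

text \<open>In Leibniz's formula for \<open>D ^^ (m + n)\<close> every other term has a vanishing
  factor. The induction on \<open>m + n\<close> gets the binomial coefficient from Pascal's
  rule.\<close>

lemma funpow_derivation_mult_top:
  assumes "(D ^^ Suc m) a = 0" "(D ^^ Suc n) b = 0"
  shows "(D ^^ (m + n)) (a * b) = of_nat ((m + n) choose m) * (D ^^ m) a * (D ^^ n) b"
  using assms
proof (induction "m + n" arbitrary: m n a b)
  case 0
  then show ?case by simp
next
  case (Suc k)
  show ?case
  proof (cases "m = 0 \<or> n = 0")
    case True
    then show ?thesis
      using Suc.prems funpow_derivation_kernel_mult[of a n b] funpow_derivation_kernel_mult[of b m a]
      by (auto simp: mult.commute)
  next
    case False
    then obtain m' n' where mn: "m = Suc m'" "n = Suc n'"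
      by (metis not0_implies_Suc)
    have k: "k = m' + n" "k = m + n'"
      using Suc.hyps(2) mn by auto
    have "(D ^^ (m + n)) (a * b) = (D ^^ k) (D a * b) + (D ^^ k) (a * D b)"
      by (simp add: Suc.hyps(2)[symmetric] funpow_swap1 derivation_mult funpow_derivation_add)
    also have "(D ^^ k) (D a * b) = of_nat (k choose m') * (D ^^ m) a * (D ^^ n) b"
      using Suc.hyps(1)[of m' n "D a" b] Suc.prems k by (simp add: mn funpow_swap1)
    also have "(D ^^ k) (a * D b) = of_nat (k choose m) * (D ^^ m) a * (D ^^ n) b"
      using Suc.hyps(1)[of m n' a "D b"] Suc.prems k by (simp add: mn funpow_swap1)
    also have "of_nat (k choose m') * (D ^^ m) a * (D ^^ n) b + of_nat (k choose m) * (D ^^ m) a * (D ^^ n) b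
        = of_nat (Suc k choose m) * (D ^^ m) a * (D ^^ n) b"
      by (simp add: mn ring_distribs)
    finally show ?thesis
      unfolding Suc.hyps(2) .
  qed
qed

text \<open>If \<open>b\<close> divides the derivative of every generator, it divides all of
  \<open>range D\<close>, since such elements form a subalgebra. Irreducibility then makes
  \<open>b\<close> a unit, impossible without a constant term.\<close>

lemma irreducible_derivation_generator:
  assumes irr: "irreducible_derivation D" and L: "adjoin (range L) = UNIV"
    and b: "b \<in> order_ge 1"
  obtains i where "\<not> b dvd D (L i)"
proof -
  have False if *: "\<And>i. b dvd D (L i)"
  proof -
    have "is_subalgebra {p. b dvd D p}"
      by (auto simp: is_subalgebra_def derivation_const derivation_add derivation_mult)
    then have "adjoin (range L) \<subseteq> {p. b dvd D p}"
      using * by (intro adjoin_subsetI) auto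
    then have "range D \<subseteq> principal_ideal UNIV b"
      using L by (auto simp: principal_ideal_def dvd_def mult.commute)
    moreover have "is_ideal (principal_ideal UNIV b)"
      unfolding is_ideal_def principal_ideal_def
      by (auto simp flip: distrib_right mult.assoc intro: exI[of _ 0])
    ultimately have "is_ideal hull (range D) \<subseteq> principal_ideal UNIV b"
      by (rule hull_minimal)
    then have "principal_ideal UNIV b = UNIV"
      using irr unfolding irreducible_derivation_def by blast
    then have "1 \<in> principal_ideal UNIV b"
      by simp
    then obtain a where "a * b = 1"
      unfolding principal_ideal_def by auto
    then have "(1 :: 'k poly3) \<in> order_ge 1"
      using order_ge_mult_left[OF b, of a] by simp
    then show False
      using order_ge_1_iff[of "1::'k poly3"] by (simp add: lookup_one)
  qed
  then show thesis using that by blast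
qed

lemma homogeneous_derivation_order_ge:
  assumes "homogeneous_derivation D (int d)" "p \<in> order_ge j"
  shows "D p \<in> order_ge (j + d)"
proof -
  have "D (Poly_Mapping.single m c) \<in> order_ge (j + d)"
    if "m \<in> Poly_Mapping.keys p" for m c
  proof -
    have "Poly_Mapping.single m c \<in> homogeneous_component (int (total_degree m))"
      by (simp add: homogeneous_component_def)
    then have "D (Poly_Mapping.single m c) \<in> homogeneous_component (int (total_degree m + d))"
      using assms(1) unfolding homogeneous_derivation_def by auto
    moreover have "j \<le> total_degree m"
      using assms(2) that by (simp add: order_ge_def)
    ultimately show ?thesis
      using homogeneous_in_order_ge order_ge_mono by (metis add_le_mono1)
  qed
  then have "D (\<Sum>m\<in>Poly_Mapping.keys p. Poly_Mapping.single m (Poly_Mapping.lookup p m)) \<in> order_ge (j + d)"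
    unfolding derivation_sum by (intro order_ge_sum)
  then show ?thesis
    by (metis poly_mapping_sum_single)
qed

end

section \<open>Linear triangular coordinates\<close>

text \<open>Moves the origin so that all coordinates lose their constant terms. Injectivity survives
  because the translations by \<open>c\<close> and by its negative are mutually inverse.\<close>

lemma coordinate_system_translate:
  assumes X: "coordinate_system X"
  shows "coordinate_system (\<lambda>i. X i - const (c i))"
  unfolding coordinate_system_def
proof
  let ?Y = "\<lambda>i. X i - const (c i)"
  have "X i \<in> adjoin (range ?Y)" for i
    using is_subalgebraD(4)[OF is_subalgebra_adjoin, of "?Y i" "range ?Y" "const (c i)"]
      adjoin_superset[of "range ?Y"] is_subalgebraD(1)[OF is_subalgebra_adjoin, of "c i" "range ?Y"]
    by auto
  then have "adjoin (range X) \<subseteq> adjoin (range ?Y)"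
    by (intro adjoin_subsetI is_subalgebra_adjoin) auto
  then show "adjoin (range ?Y) = UNIV"
    using X by (auto simp: coordinate_system_def)
  show "inj (subst ?Y)"
  proof (rule injI)
    fix p q assume eq: "subst ?Y p = subst ?Y q"
    have "subst ?Y r = subst X (subst (\<lambda>i. var i - const (c i)) r)" for r
      by (simp add: subst_subst subst_diff)
    then have "subst (\<lambda>i. var i - const (c i)) p = subst (\<lambda>i. var i - const (c i)) q"
      using X eq by (simp add: coordinate_system_def inj_eq)
    then have "subst (\<lambda>i. var i + const (c i)) (subst (\<lambda>i. var i - const (c i)) p)
        = subst (\<lambda>i. var i + const (c i)) (subst (\<lambda>i. var i - const (c i)) q)"
      by simp
    then show "p = q"
      by (simp add: subst_subst subst_diff)
  qed
qed

text \<open>Surjectivity of the substitution provides \<open>G\<close>; injectivity makes it an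
  inverse on the other side too. Since \<open>X\<close> vanishes at the origin, the constant term of
  \<open>G i\<close> is that of \<open>var i\<close>, hence zero.\<close>

lemma coordinate_system_inverse:
  assumes X: "coordinate_system X" "\<And>i. X i \<in> order_ge 1"
  obtains G where "\<And>i. subst X (G i) = var i" "\<And>i. G i \<in> order_ge 1" "\<And>p. subst G (subst X p) = p"
proof -
  have "\<exists>g. subst X g = var i" for i
    using X(1) adjoin_subset_subst[of X UNIV] unfolding coordinate_system_def by (auto simp: image_iff)
      (metis UNIV_I image_iff subset_iff)
  then obtain G where G: "\<And>i. subst X (G i) = var i" by metis
  have "G i \<in> order_ge 1" for i
  proof -
    let ?c = "Poly_Mapping.lookup (G i) 0"
    have "G i - const ?c \<in> order_ge 1"
      by (simp add: order_ge_1_iff[unfolded One_nat_def] lookup_minus lookup_const)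
    then have "subst X (G i - const ?c) \<in> order_ge 1"
      by (rule subst_order_ge[OF X(2)])
    then have "var i - const ?c \<in> order_ge 1"
      by (simp add: subst_diff G)
    then have "const ?c \<in> order_ge 1"
      using order_ge_diff[OF var_order_ge[of i]] by fastforce
    then have "?c = 0"
      by (simp only: order_ge_1_iff lookup_const when_simps simp_thms)
    then show ?thesis
      by (simp only: order_ge_1_iff)
  qed
  moreover have "subst G (subst X p) = p" for p
  proof -
    have "subst X (subst G (subst X p)) = subst X p"
      by (simp add: subst_subst[of X G] G)
    then show ?thesis
      using X(1) by (simp add: coordinate_system_def inj_eq)
  qed
  ultimately show thesis
    using that G by blast
qed

text \<open>The coordinate change has invertible linear part: in
  \<open>subst X (G i) = var i\<close> the terms of degree one say that \<open>var i\<close> is the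
  linear part of \<open>G i\<close> evaluated at \<open>L\<close>.\<close>

lemma linear_parts_generate:
  assumes X: "coordinate_system X" "\<And>i. X i \<in> order_ge 1"
    and L: "\<And>i. L i \<in> homogeneous_component 1" "\<And>i. X i - L i \<in> order_ge 2"
  shows "adjoin (range L) = UNIV"
proof -
  have L1: "L i \<in> order_ge 1" for i
    using homogeneous_in_order_ge[of "L i" 1] L(1) by simp
  obtain G where G: "\<And>i. subst X (G i) = var i" "\<And>i. G i \<in> order_ge 1"
    using coordinate_system_inverse[OF X] by metis
  have "var i \<in> adjoin (range L)" for i
  proof -
    obtain q where q: "q \<in> homogeneous_component (int 1)" "G i - q \<in> order_ge (Suc 1)"
      using order_ge_split[OF G(2)] by metis
    have "subst X (G i - q) \<in> order_ge (Suc 1)"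
      using subst_order_ge[OF X(2) q(2)] .
    moreover have "subst X q - subst L q \<in> order_ge (Suc 1)"
      using subst_diff_order_ge[OF X(2) L1 L(2)] homogeneous_in_order_ge[OF q(1)] .
    ultimately have "subst X (G i - q) + (subst X q - subst L q) \<in> order_ge (Suc 1)"
      by (rule order_ge_add)
    then have "var i - subst L q \<in> order_ge (Suc 1)"
      by (simp add: subst_diff G)
    moreover have "var i - subst L q \<in> homogeneous_component (int 1)"
      using subst_homogeneous[OF L(1), of q 1] q(1) var_homogeneous by (intro homogeneous_diff) auto
    ultimately have "var i = subst L q"
      using homogeneous_order_ge_Suc_eq_0 by fastforce
    then show ?thesis
      using subst_in_subalgebra[OF is_subalgebra_adjoin adjoin_superset] by simp
  qed
  then have "subst var p \<in> adjoin (range L)" for p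
    by (intro subst_in_subalgebra is_subalgebra_adjoin) auto
  then show ?thesis by auto
qed

text \<open>\<open>D\<close> raises order by \<open>d\<close>, so comparing the terms of degree
  \<open>d + 1\<close> in \<open>D (X j) = subst X p\<close> leaves \<open>D (L j)\<close> on one
  side and the degree \<open>d + 1\<close> part of \<open>p\<close>, evaluated at \<open>L\<close>,
  on the other.\<close>

lemma linear_part_derivation:
  fixes D :: "'k::comm_ring_1 poly3 \<Rightarrow> 'k poly3"
  assumes D: "derivation D" "homogeneous_derivation D (int d)"
    and X: "coordinate_system X" "\<And>i. X i \<in> order_ge 1"
    and L: "\<And>i. L i \<in> homogeneous_component 1" "\<And>i. X i - L i \<in> order_ge 2"
    and p: "D (X j) = subst X p"
  obtains q where "q \<in> homogeneous_component (int (Suc d))"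
    "Poly_Mapping.keys q \<subseteq> Poly_Mapping.keys p" "D (L j) = subst L q"
proof -
  have L1: "L i \<in> order_ge 1" for i
    using homogeneous_in_order_ge[of "L i" 1] L(1) by simp
  obtain G where G: "\<And>i. G i \<in> order_ge 1" "\<And>p. subst G (subst X p) = p"
    using coordinate_system_inverse[OF X] by metis
  have "subst X p \<in> order_ge (Suc d)"
    using homogeneous_derivation_order_ge[OF D X(2), of j] p by simp
  \<comment> \<open>The inverse substitution preserves order as well, so the bound passes from
    \<open>D (X j)\<close> to \<open>p\<close> itself.\<close>
  then have "subst G (subst X p) \<in> order_ge (Suc d)"
    by (rule subst_order_ge[OF G(1)])
  then have "p \<in> order_ge (Suc d)"
    by (simp add: G(2))
  then obtain q where q: "q \<in> homogeneous_component (int (Suc d))" "p - q \<in> order_ge (Suc (Suc d))"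
    "Poly_Mapping.keys q \<subseteq> Poly_Mapping.keys p"
    using order_ge_split by metis
  have "D (X j - L j) \<in> order_ge (Suc (Suc d))"
    using homogeneous_derivation_order_ge[OF D L(2), of j] by simp
  moreover have "subst X (p - q) \<in> order_ge (Suc (Suc d))"
    using subst_order_ge[OF X(2) q(2)] .
  moreover have "subst X q - subst L q \<in> order_ge (Suc (Suc d))"
    using subst_diff_order_ge[OF X(2) L1 L(2)] homogeneous_in_order_ge[OF q(1)] .
  \<comment> \<open>As \<open>D (X j) = subst X p\<close>, this combination collapses to
    \<open>D (L j) - subst L q\<close>.\<close>
  ultimately have "subst X (p - q) + (subst X q - subst L q) - D (X j - L j) \<in> order_ge (Suc (Suc d))"
    using order_ge_add order_ge_diff by blast
  then have "D (L j) - subst L q \<in> order_ge (Suc (Suc d))"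
    by (simp add: subst_diff derivation_diff[OF D(1)] p)
  moreover have "D (L j) \<in> homogeneous_component (int (Suc d))"
    using D(2) L(1)[of j] unfolding homogeneous_derivation_def
    by (metis image_subset_iff of_nat_Suc)
  then have "D (L j) - subst L q \<in> homogeneous_component (int (Suc d))"
    using subst_homogeneous[OF L(1) q(1)] by (intro homogeneous_diff)
  ultimately have "D (L j) = subst L q"
    using homogeneous_order_ge_Suc_eq_0 by fastforce
  then show thesis
    using that q by blast
qed

section \<open>Homogeneous polynomials in one and two of the variables\<close>

lemma prod_3: "prod f (UNIV :: 3 set) = f 1 * f 2 * f 3"
  unfolding UNIV_3 by (simp add: mult.assoc)

lemma subst_homogeneous_one:
  assumes "q \<in> homogeneous_component (int e)"
    and "\<And>m. m \<in> Poly_Mapping.keys q \<Longrightarrow> Poly_Mapping.lookup m 2 = 0 \<and> Poly_Mapping.lookup m 3 = 0"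
  shows "\<exists>a. subst L q = const a * L 1 ^ e"
proof -
  have "subst L q = (\<Sum>m\<in>Poly_Mapping.keys q. const (Poly_Mapping.lookup q m) * L 1 ^ e)"
    unfolding subst_def
  proof (rule sum.cong[OF refl])
    fix m assume m: "m \<in> Poly_Mapping.keys q"
    with assms have "Poly_Mapping.lookup m 2 = 0" "Poly_Mapping.lookup m 3 = 0"
      "Poly_Mapping.lookup m 1 = e"
      by (auto simp: homogeneous_component_def total_degree_def sum_3)
    then show "const (Poly_Mapping.lookup q m) * (\<Prod>i\<in>UNIV. L i ^ Poly_Mapping.lookup m i)
        = const (Poly_Mapping.lookup q m) * L 1 ^ e"
      by (simp add: prod_3)
  qed
  then show ?thesis
    by (metis const_sum sum_distrib_right)
qed

lemma subst_homogeneous_two: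
  assumes "q \<in> homogeneous_component (int e)"
    and "\<And>m. m \<in> Poly_Mapping.keys q \<Longrightarrow> Poly_Mapping.lookup m 3 = 0"
  shows "\<exists>c. subst L q = (\<Sum>i\<le>e. const (c i) * L 1 ^ (e - i) * L 2 ^ i)"
proof -
  have deg: "Poly_Mapping.lookup m 3 = 0" "Poly_Mapping.lookup m 1 = e - Poly_Mapping.lookup m 2"
    "Poly_Mapping.lookup m 2 \<le> e" if "m \<in> Poly_Mapping.keys q" for m
    using assms that by (auto simp: homogeneous_component_def total_degree_def sum_3)
  \<comment> \<open>At most one monomial contributes to each \<open>?c i\<close>; the sum form suits
    \<open>sum.group\<close> and yields zero when there is none.\<close>
  let ?c = "\<lambda>i. \<Sum>m | m \<in> Poly_Mapping.keys q \<and> Poly_Mapping.lookup m 2 = i. Poly_Mapping.lookup q m"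
  have "subst L q = (\<Sum>m\<in>Poly_Mapping.keys q. const (Poly_Mapping.lookup q m) *
      (L 1 ^ (e - Poly_Mapping.lookup m 2) * L 2 ^ Poly_Mapping.lookup m 2))"
    unfolding subst_def by (rule sum.cong) (simp_all add: prod_3 deg)
  also have "\<dots> = (\<Sum>i\<le>e. \<Sum>m | m \<in> Poly_Mapping.keys q \<and> Poly_Mapping.lookup m 2 = i.
      const (Poly_Mapping.lookup q m) *
      (L 1 ^ (e - Poly_Mapping.lookup m 2) * L 2 ^ Poly_Mapping.lookup m 2))"
    by (rule sum.group[symmetric]) (auto simp: deg)
  also have "\<dots> = (\<Sum>i\<le>e. const (?c i) * L 1 ^ (e - i) * L 2 ^ i)"
    by (rule sum.cong) (auto simp: const_sum sum_distrib_right mult.assoc intro!: sum.cong)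
  finally show ?thesis
    by (intro exI[of _ ?c])
qed

text \<open>Triangular coordinates are first translated to the origin and then replaced by their
  linear parts; neither operation brings further variables into the derivatives.\<close>

lemma triangularizable_linear_coordinates:
  fixes D :: "'k::comm_ring_1 poly3 \<Rightarrow> 'k poly3"
  assumes D: "derivation D" "homogeneous_derivation D (int d)" and tri: "triangularizable D"
  obtains L :: "3 \<Rightarrow> 'k poly3" and a c where "\<And>i. L i \<in> homogeneous_component 1" "adjoin (range L) = UNIV"
    "D (L 1) = 0" "D (L 2) = const a * L 1 ^ Suc d"
    "D (L 3) = (\<Sum>i\<le>Suc d. const (c i) * L 1 ^ (Suc d - i) * L 2 ^ i)"
proof -
  obtain X' where X': "coordinate_system X'" "D (X' 1) \<in> range const"
    "D (X' 2) \<in> adjoin {X' 1}" "D (X' 3) \<in> adjoin {X' 1, X' 2}"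
    using tri unfolding triangularizable_def by blast
  define X where "X i = X' i - const (Poly_Mapping.lookup (X' i) 0)" for i
  have X: "coordinate_system X"
    unfolding X_def by (rule coordinate_system_translate[OF X'(1)])
  have X1: "X i \<in> order_ge 1" for i
    by (simp add: order_ge_1_iff[unfolded One_nat_def] X_def lookup_minus lookup_const)
  have DX: "D (X i) = D (X' i)" for i
    by (simp add: X_def derivation_diff[OF D(1)] derivation_const[OF D(1)])
  have X'_in: "adjoin (X' ` I) \<subseteq> adjoin (X ` I)" for I
  proof (rule adjoin_subsetI[OF _ is_subalgebra_adjoin])
    show "X' ` I \<subseteq> adjoin (X ` I)"
    proof
      fix y assume "y \<in> X' ` I"
      then obtain i where i: "i \<in> I" "y = X i + const (Poly_Mapping.lookup (X' i) 0)"
        by (auto simp: X_def)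
      then show "y \<in> adjoin (X ` I)"
        using adjoin_superset[of "X ` I"] by (auto intro!: is_subalgebraD is_subalgebra_adjoin)
    qed
  qed
  have form: "\<exists>p. D (X j) = subst X p \<and> (\<forall>m\<in>Poly_Mapping.keys p. \<forall>i. i \<notin> I \<longrightarrow> Poly_Mapping.lookup m i = 0)"
    if "D (X' j) \<in> adjoin (X' ` I)" for j I
    using that X'_in[of I] adjoin_subset_subst[of X I] unfolding DX by blast
  have "\<exists>q. q \<in> homogeneous_component 1 \<and> X i - q \<in> order_ge 2" for i
    using order_ge_split[OF X1, of i] by (metis Suc_1 of_nat_1)
  then obtain L where L: "\<And>i. L i \<in> homogeneous_component 1" "\<And>i. X i - L i \<in> order_ge 2"
    by metis
  have lin: "\<exists>q. q \<in> homogeneous_component (int (Suc d)) \<and>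
      (\<forall>m\<in>Poly_Mapping.keys q. \<forall>i. i \<notin> I \<longrightarrow> Poly_Mapping.lookup m i = 0) \<and> D (L j) = subst L q"
    if "D (X' j) \<in> adjoin (X' ` I)" for j I
  proof -
    obtain p where p: "D (X j) = subst X p"
      "\<forall>m\<in>Poly_Mapping.keys p. \<forall>i. i \<notin> I \<longrightarrow> Poly_Mapping.lookup m i = 0"
      using form[OF \<open>D (X' j) \<in> adjoin (X' ` I)\<close>] by blast
    show ?thesis
      using linear_part_derivation[OF D X X1 L p(1)] p(2) by (metis subsetD)
  qed
  obtain q2 where "q2 \<in> homogeneous_component (int (Suc d))"
    "\<forall>m\<in>Poly_Mapping.keys q2. \<forall>i. i \<notin> {1} \<longrightarrow> Poly_Mapping.lookup m i = 0" "D (L 2) = subst L q2"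
    using lin[of 2 "{1}"] X' by auto
  then obtain a where a: "D (L 2) = const a * L 1 ^ Suc d"
    using subst_homogeneous_one[of q2 "Suc d" L] by auto
  obtain q3 where "q3 \<in> homogeneous_component (int (Suc d))"
    "\<forall>m\<in>Poly_Mapping.keys q3. \<forall>i. i \<notin> {1, 2} \<longrightarrow> Poly_Mapping.lookup m i = 0" "D (L 3) = subst L q3"
    using lin[of 3 "{1, 2}"] X' by auto
  then obtain c where c: "D (L 3) = (\<Sum>i\<le>Suc d. const (c i) * L 1 ^ (Suc d - i) * L 2 ^ i)"
    using subst_homogeneous_two[of q3 "Suc d" L] by auto
  obtain b where b: "D (X 1) = const b"
    using X'(2) DX by auto
  \<comment> \<open>Because \<open>d\<close> is nonnegative, \<open>D (X 1)\<close> has no constant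
    term; being constant, it is zero.\<close>
  moreover have "D (X 1) \<in> order_ge 1"
    using homogeneous_derivation_order_ge[OF D X1, of 1] order_ge_mono by fastforce
  ultimately have "b = 0"
    by (simp only: order_ge_1_iff lookup_const when_simps simp_thms)
  then have "D (X 1) = subst X 0"
    using b by simp
  then obtain q1 where "Poly_Mapping.keys q1 \<subseteq> Poly_Mapping.keys (0 :: 'k poly3)" "D (L 1) = subst L q1"
    using linear_part_derivation[OF D X X1 L] by metis
  then have "D (L 1) = 0"
    by (simp add: subst_def)
  then show thesis
    using that[OF L(1) linear_parts_generate[OF X X1 L]] a c by blast
qed

section \<open>Image ideals in linear triangular coordinates\<close>

text \<open>Over a field and for nonzero \<open>X\<close>, \<open>n\<close> is the nilpotency degree
  of \<open>b\<close>. The scalar stays anonymous, so products and powers only track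
  \<open>n\<close> and \<open>m\<close>.\<close>

definition leading_term :: "('k::comm_ring_1 poly3 \<Rightarrow> 'k poly3) \<Rightarrow> 'k poly3 \<Rightarrow> nat \<Rightarrow> nat \<Rightarrow> 'k poly3 \<Rightarrow> bool" where
  "leading_term D X n m b \<longleftrightarrow> (D ^^ Suc n) b = 0 \<and> (\<exists>c. c \<noteq> 0 \<and> (D ^^ n) b = const c * X ^ m)"

text \<open>Only the top Leibniz term survives; its binomial coefficient is nonzero in
  characteristic zero.\<close>

lemma leading_term_mult:
  fixes D :: "'k::field_char_0 poly3 \<Rightarrow> 'k poly3"
  assumes D: "derivation D" and X: "D X = 0"
    and b: "leading_term D X n m b" "leading_term D X n' m' b'"
  shows "leading_term D X (n + n') (m + m') (b * b')"
proof -
  obtain c c' where c: "c \<noteq> 0" "(D ^^ n) b = const c * X ^ m" "c' \<noteq> 0" "(D ^^ n') b' = const c' * X ^ m'"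
    using b unfolding leading_term_def by auto
  let ?c = "of_nat ((n + n') choose n) * c * c'"
  have eq: "(D ^^ (n + n')) (b * b') = const ?c * X ^ (m + m')"
    using funpow_derivation_mult_top[OF D, of n b n' b'] b c
    by (simp add: leading_term_def const_mult const_of_nat power_add mult_ac)
  moreover have "?c \<noteq> 0"
    using c by simp
  moreover have "(D ^^ Suc (n + n')) (b * b') = 0"
    using eq X by (simp add: derivation_const_mult[OF D] derivation_power[OF D])
  ultimately show ?thesis
    unfolding leading_term_def by blast
qed

lemma leading_term_power:
  fixes D :: "'k::field_char_0 poly3 \<Rightarrow> 'k poly3"
  assumes D: "derivation D" and X: "D X = 0" and b: "leading_term D X n m b"
  shows "leading_term D X (i * n) (i * m) (b ^ i)"
proof (induction i)
  case 0
  show ?case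
    using derivation_const[OF D, of 1] by (auto simp: leading_term_def intro: exI[of _ 1])
next
  case (Suc i)
  then show ?case
    using leading_term_mult[OF D X b] by simp
qed

text \<open>The normal form, with \<open>L 1\<close>, \<open>L 2\<close>, \<open>L 3\<close> in the
  roles of \<open>X\<close>, \<open>Y\<close>, \<open>Z\<close>.\<close>

locale linear_triangular_derivation =
  fixes D :: "'k::field_char_0 poly3 \<Rightarrow> 'k poly3" and L :: "3 \<Rightarrow> 'k poly3"
    and e :: nat and a :: 'k and c :: "nat \<Rightarrow> 'k"
  assumes D: "derivation D" and generate: "adjoin (range L) = UNIV"
    and D1: "D (L 1) = 0" and D2: "D (L 2) = const a * L 1 ^ e"
    and D3: "D (L 3) = (\<Sum>i\<le>e. const (c i) * L 1 ^ (e - i) * L 2 ^ i)"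
    and L1: "L 1 \<noteq> 0" and a: "a \<noteq> 0" and c: "c e \<noteq> 0"
begin

lemma leading_term_L2: "leading_term D (L 1) 1 e (L 2)"
  using a by (auto simp: leading_term_def D2 derivation_const_mult[OF D] derivation_power[OF D] D1)

lemma leading_term_L2_power: "leading_term D (L 1) i (i * e) (L 2 ^ i)"
  using leading_term_power[OF D D1 leading_term_L2, of i] by simp

text \<open>\<open>D ^^ e\<close> kills \<open>L 2 ^ i\<close> for \<open>i < e\<close>, so only the
  pure power \<open>L 2 ^ e\<close> in \<open>D (L 3)\<close> contributes; its coefficient
  \<open>c e\<close> is nonzero.\<close>

lemma leading_term_L3: "leading_term D (L 1) (Suc e) (e * e) (L 3)"
proof -
  have pow: "D (const (c i) * L 1 ^ (e - i)) = 0" for i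
    by (simp add: derivation_const_mult[OF D] derivation_power[OF D] D1)
  have "(D ^^ e) (D (L 3)) = (\<Sum>i\<le>e. const (c i) * L 1 ^ (e - i) * (D ^^ e) (L 2 ^ i))"
    by (simp add: D3 funpow_derivation_sum[OF D] funpow_derivation_kernel_mult[OF D pow])
  also have "\<dots> = (\<Sum>i\<in>{e}. const (c i) * L 1 ^ (e - i) * (D ^^ e) (L 2 ^ i))"
  proof (rule sum.mono_neutral_right)
    show "\<forall>i\<in>{..e} - {e}. const (c i) * L 1 ^ (e - i) * (D ^^ e) (L 2 ^ i) = 0"
    proof
      fix i assume "i \<in> {..e} - {e}"
      then have "Suc i \<le> e" by auto
      moreover have "(D ^^ Suc i) (L 2 ^ i) = 0"
        using leading_term_L2_power[of i] by (simp only: leading_term_def)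
      ultimately show "const (c i) * L 1 ^ (e - i) * (D ^^ e) (L 2 ^ i) = 0"
        using funpow_derivation_eq_0_mono[OF D, of "Suc i" "L 2 ^ i" e] by simp
    qed
  qed auto
  also have "\<dots> = const (c e) * (D ^^ e) (L 2 ^ e)"
    by simp
  finally have eq: "(D ^^ Suc e) (L 3) = const (c e) * (D ^^ e) (L 2 ^ e)"
    by (simp only: funpow_Suc_right comp_apply)
  obtain b where b: "b \<noteq> 0" "(D ^^ e) (L 2 ^ e) = const b * L 1 ^ (e * e)" "(D ^^ Suc e) (L 2 ^ e) = 0"
    using leading_term_L2_power[of e] unfolding leading_term_def by blast
  have "(D ^^ Suc (Suc e)) (L 3) = D ((D ^^ Suc e) (L 3))"
    by simp
  also have "\<dots> = const (c e) * (D ^^ Suc e) (L 2 ^ e)"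
    unfolding eq by (simp add: derivation_const_mult[OF D])
  finally have "(D ^^ Suc (Suc e)) (L 3) = 0"
    using b(3) by simp
  moreover have "(D ^^ Suc e) (L 3) = const (c e * b) * L 1 ^ (e * e)"
    unfolding eq b(2) by (simp add: const_mult mult.assoc)
  ultimately show ?thesis
    unfolding leading_term_def using b(1) c by (metis mult_eq_0_iff)
qed

text \<open>These are the \<open>E\<^sub>n\<close>: as \<open>L 3\<close> has nilpotency degree
  \<open>e + 1\<close> and \<open>L 2\<close> has degree 1, division by \<open>Suc e\<close> gives
  one element of each degree \<open>n\<close>.\<close>

definition module_basis :: "nat \<Rightarrow> 'k poly3" where
  "module_basis n = L 3 ^ (n div Suc e) * L 2 ^ (n mod Suc e)"

definition image_exponent :: "nat \<Rightarrow> nat" where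
  "image_exponent n = (n div Suc e) * (e * e) + (n mod Suc e) * e"

lemma leading_term_module_basis: "leading_term D (L 1) n (image_exponent n) (module_basis n)"
  using leading_term_mult[OF D D1 leading_term_power[OF D D1 leading_term_L3, of "n div Suc e"]
      leading_term_L2_power[of "n mod Suc e"]]
  by (simp only: image_exponent_def module_basis_def div_mult_mod_eq)

section \<open>The polynomial ring as a module over the kernel\<close>

definition module_span :: "'k poly3 set" where
  "module_span = {\<Sum>n<N. q n * module_basis n | q N. \<forall>n. D (q n) = 0}"

lemma module_spanI: "(\<And>n. D (q n) = 0) \<Longrightarrow> (\<Sum>n<N. q n * module_basis n) \<in> module_span"
  unfolding module_span_def by blast

lemma module_span_add:
  assumes "p \<in> module_span" "p' \<in> module_span"
  shows "p + p' \<in> module_span"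
proof -
  obtain q N q' N' where q: "\<And>n. D (q n) = 0" "p = (\<Sum>n<N. q n * module_basis n)"
    and q': "\<And>n. D (q' n) = 0" "p' = (\<Sum>n<N'. q' n * module_basis n)"
    using assms unfolding module_span_def by blast
  have extend: "(\<Sum>n<M. r n * module_basis n)
      = (\<Sum>n<max N N'. (if n < M then r n else 0) * module_basis n)"
    if "M \<le> max N N'" for M and r :: "nat \<Rightarrow> 'k poly3"
    using that by (intro sum.mono_neutral_cong_left) auto
  have "p + p' = (\<Sum>n<max N N'. ((if n < N then q n else 0) + (if n < N' then q' n else 0)) * module_basis n)"
    unfolding q(2) q'(2) extend[of N q, simplified] extend[of N' q', simplified]
    by (simp only: sum.distrib[symmetric] distrib_right)
  also have "\<dots> \<in> module_span"
    using q(1) q'(1) by (intro module_spanI) (simp add: derivation_add[OF D] derivation_0[OF D])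
  finally show ?thesis .
qed

lemma module_span_zero: "0 \<in> module_span"
  using module_spanI[of "\<lambda>_. 0" 0] by (simp add: derivation_0[OF D])

lemma module_span_sum: "(\<And>i. i \<in> I \<Longrightarrow> f i \<in> module_span) \<Longrightarrow> sum f I \<in> module_span"
  by (induction I rule: infinite_finite_induct) (auto intro: module_span_add module_span_zero)

lemma module_span_mult_kernel:
  assumes "D r = 0" "p \<in> module_span"
  shows "r * p \<in> module_span"
proof -
  obtain q N where q: "\<And>n. D (q n) = 0" "p = (\<Sum>n<N. q n * module_basis n)"
    using assms(2) unfolding module_span_def by blast
  have "r * p = (\<Sum>n<N. (r * q n) * module_basis n)"
    by (simp add: q(2) sum_distrib_left mult.assoc)
  then show ?thesis
    using assms(1) q(1) by (auto intro!: module_spanI simp: derivation_mult[OF D])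
qed

lemma module_basis_in_module_span: "module_basis n \<in> module_span"
proof -
  have "module_basis n = (\<Sum>i<Suc n. (if i = n then 1 else 0) * module_basis i)"
    by simp
  also have "\<dots> \<in> module_span"
    using derivation_const[OF D, of 1] by (intro module_spanI) (simp add: derivation_0[OF D])
  finally show ?thesis .
qed

text \<open>Multiplication by any \<open>r\<close> is linear over the kernel, so it can be tested on
  the spanning elements.\<close>

lemma module_span_mult:
  assumes "\<And>n. r * module_basis n \<in> module_span" "p \<in> module_span"
  shows "r * p \<in> module_span"
proof -
  obtain q N where q: "\<And>n. D (q n) = 0" "p = (\<Sum>n<N. q n * module_basis n)"
    using assms(2) unfolding module_span_def by blast
  have "r * p = (\<Sum>n<N. q n * (r * module_basis n))"
    by (simp add: q(2) sum_distrib_left mult_ac)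
  then show ?thesis
    using assms(1) q(1) by (simp add: module_span_sum module_span_mult_kernel)
qed

lemma module_span_L3: "p \<in> module_span \<Longrightarrow> L 3 * p \<in> module_span"
proof (rule module_span_mult)
  fix n
  have "L 3 * module_basis n = module_basis (n + Suc e)"
    unfolding module_basis_def by (simp only: div_add_self2 mod_add_self2) simp
  then show "L 3 * module_basis n \<in> module_span"
    using module_basis_in_module_span by simp
qed

lemma module_span_L3_power: "p \<in> module_span \<Longrightarrow> L 3 ^ t * p \<in> module_span"
  by (induction t) (auto simp: mult.assoc intro: module_span_L3)

lemma L2_power_in_module_span: "i \<le> e \<Longrightarrow> L 2 ^ i \<in> module_span"
  using module_basis_in_module_span[of i] by (simp add: module_basis_def)

text \<open>The kernel element \<open>P\<close> is a relation that can be solved for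
  \<open>L 2 ^ Suc e\<close>, in terms of \<open>L 3\<close>, 1 and lower powers of
  \<open>L 2\<close> with coefficients in the kernel.\<close>

lemma L2_power_Suc_in_module_span: "L 2 ^ Suc e \<in> module_span"
proof -
  \<comment> \<open>Termwise integration of \<open>D (L 3) / a\<close> in \<open>L 2\<close>: the
    divisor cancels the factor \<open>a * (i + 1)\<close> produced by differentiating
    \<open>L 2 ^ Suc i\<close>.\<close>
  define f where "f i = c i / (a * of_nat (Suc i))" for i
  define F where "F i = const (f i) * L 1 ^ (e - i) * L 2 ^ Suc i" for i
  define P where "P = L 1 ^ e * L 3 - (\<Sum>i\<le>e. F i)"
  have D1': "D (L 1 ^ i) = 0" for i
    by (simp add: derivation_power[OF D] D1)
  have F: "D (F i) = L 1 ^ e * (const (c i) * L 1 ^ (e - i) * L 2 ^ i)" for i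
  proof -
    have "D (F i) = const (f i) * L 1 ^ (e - i) * D (L 2 ^ Suc i)"
      unfolding F_def by (intro derivation_kernel_mult[OF D]) (simp add: derivation_const_mult[OF D] D1')
    also have "D (L 2 ^ Suc i) = const (of_nat (Suc i)) * L 2 ^ i * (const a * L 1 ^ e)"
      unfolding derivation_power[OF D] D2 const_of_nat by simp
    also have "const (f i) * L 1 ^ (e - i) * \<dots>
        = const (f i * of_nat (Suc i) * a) * (L 1 ^ e * L 1 ^ (e - i) * L 2 ^ i)"
      by (simp only: const_mult mult_ac)
    also have "f i * of_nat (Suc i) * a = c i"
      using a by (simp add: f_def del: of_nat_Suc)
    finally show ?thesis by (simp only: mult_ac)
  qed
  have "D P = 0"
    by (simp add: P_def derivation_diff[OF D] derivation_sum[OF D] F derivation_kernel_mult[OF D D1'] D3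
        sum_distrib_left)
  have fe: "f e \<noteq> 0"
    using a c by (simp add: f_def del: of_nat_Suc)
  have "(\<Sum>i\<le>e. F i) = F e + (\<Sum>i<e. F i)"
    by (simp only: sum.lessThan_Suc lessThan_Suc_atMost[symmetric] add.commute)
  \<comment> \<open>The factor 1 is \<open>module_basis 0\<close>, so that \<open>- P\<close> enters
    as a coefficient from the kernel.\<close>
  then have Fe: "F e = L 1 ^ e * L 3 + (- P) * 1 + (\<Sum>i<e. (const (- f i) * L 1 ^ (e - i)) * L 2 ^ Suc i)"
    by (simp add: P_def F_def const_uminus sum_negf)
  have 1: "1 \<in> module_span"
    using module_basis_in_module_span[of 0] by (simp add: module_basis_def)
  have "L 1 ^ e * L 3 \<in> module_span"
    using module_span_mult_kernel[OF D1' module_span_L3[OF 1]] by simp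
  moreover have "(- P) * 1 \<in> module_span"
    using \<open>D P = 0\<close> derivation_diff[OF D, of 0 P] derivation_0[OF D]
    by (intro module_span_mult_kernel 1) simp
  moreover have "(\<Sum>i<e. (const (- f i) * L 1 ^ (e - i)) * L 2 ^ Suc i) \<in> module_span"
    by (intro module_span_sum module_span_mult_kernel L2_power_in_module_span)
      (auto simp: derivation_const_mult[OF D] D1')
  ultimately have "F e \<in> module_span"
    unfolding Fe by (intro module_span_add)
  then have "const (inverse (f e)) * F e \<in> module_span"
    by (intro module_span_mult_kernel derivation_const[OF D])
  moreover have "const (inverse (f e)) * F e = const (inverse (f e) * f e) * L 2 ^ Suc e"
    by (simp add: F_def const_mult mult.assoc)
  ultimately show ?thesis
    using fe by simp
qed

text \<open>The remainder can overflow only at \<open>e\<close>, where the relation for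
  \<open>L 2 ^ Suc e\<close> takes over; the power of \<open>L 3\<close> is multiplied back
  afterwards.\<close>

lemma module_span_L2: "p \<in> module_span \<Longrightarrow> L 2 * p \<in> module_span"
proof (rule module_span_mult)
  fix n
  have "L 2 ^ Suc (n mod Suc e) \<in> module_span"
  proof (cases "n mod Suc e = e")
    case True
    then show ?thesis using L2_power_Suc_in_module_span by simp
  next
    case False
    then have "Suc (n mod Suc e) \<le> e"
      using mod_less_divisor[of "Suc e" n] by linarith
    then show ?thesis by (rule L2_power_in_module_span)
  qed
  then show "L 2 * module_basis n \<in> module_span"
    using module_span_L3_power[of "L 2 ^ Suc (n mod Suc e)"]
    by (simp add: module_basis_def mult.left_commute)
qed

text \<open>The multipliers that preserve the span form a subalgebra containing all generators,
  hence everything; apply them to 1.\<close>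

lemma module_span_eq_UNIV: "module_span = UNIV"
proof -
  let ?S = "{r. \<forall>p\<in>module_span. r * p \<in> module_span}"
  have "is_subalgebra ?S"
    unfolding is_subalgebra_def
    by (auto simp: ring_distribs mult.assoc derivation_const[OF D]
        intro: module_span_add module_span_mult_kernel)
  moreover have "L i \<in> ?S" for i
    using exhaust_3[of i] module_span_L2 module_span_L3 module_span_mult_kernel[OF D1] by blast
  ultimately have "adjoin (range L) \<subseteq> ?S"
    by (intro adjoin_subsetI) auto
  then have "r * 1 \<in> module_span" for r
    using generate L2_power_in_module_span[of 0] by fastforce
  then show ?thesis by auto
qed

text \<open>Induction strips off the top summand: beyond index \<open>n\<close> its coefficient must
  vanish, at \<open>n\<close> it alone survives \<open>D ^^ n\<close>, and below \<open>n\<close>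
  everything is killed.\<close>

lemma funpow_derivation_in_principal_ideal:
  assumes "\<And>i. D (q i) = 0" "D ((D ^^ n) (\<Sum>i<N. q i * module_basis i)) = 0"
  shows "\<exists>r. D r = 0 \<and> (D ^^ n) (\<Sum>i<N. q i * module_basis i) = r * L 1 ^ image_exponent n"
  using assms(2)
proof (induction N)
  case 0
  then show ?case
    using derivation_0[OF D] funpow_derivation_0[OF D] by (auto intro: exI[of _ 0])
next
  case (Suc N)
  have vanish: "(D ^^ m) (\<Sum>i<M. q i * module_basis i) = 0" if "M \<le> m" for m M
  proof -
    have "(D ^^ m) (module_basis i) = 0" if "i < M" for i
      using leading_term_module_basis[of i] \<open>i < M\<close> \<open>M \<le> m\<close>
        funpow_derivation_eq_0_mono[OF D, of "Suc i" "module_basis i" m]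
      by (simp add: leading_term_def)
    then show ?thesis
      by (simp add: funpow_derivation_sum[OF D] funpow_derivation_kernel_mult[OF D assms(1)])
  qed
  obtain b where b: "b \<noteq> 0" "(D ^^ N) (module_basis N) = const b * L 1 ^ image_exponent N"
    using leading_term_module_basis[of N] unfolding leading_term_def by blast
  have top: "(D ^^ N) (\<Sum>i<Suc N. q i * module_basis i) = q N * const b * L 1 ^ image_exponent N"
    by (simp add: funpow_derivation_add[OF D] funpow_derivation_kernel_mult[OF D assms(1)]
        vanish b(2) mult.assoc)
  consider "N < n" | "N = n" | "n < N" by linarith
  then show ?case
  proof cases
    case 1
    then have "(D ^^ n) (\<Sum>i<Suc N. q i * module_basis i) = 0"
      by (intro vanish) simp
    then show ?thesis
      by (intro exI[of _ 0]) (simp add: derivation_0[OF D])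
  next
    case 2
    then show ?thesis
      using top assms(1)[of N]
      by (intro exI[of _ "q N * const b"]) (simp add: derivation_mult[OF D] derivation_const[OF D])
  next
    case 3
    \<comment> \<open>Since \<open>N\<close> exceeds \<open>n\<close>, \<open>D ^^ N\<close> also
      kills the sum, yet it leaves \<open>q N\<close> times a nonzero element of a domain.\<close>
    have "(D ^^ Suc n) (\<Sum>i<Suc N. q i * module_basis i) = 0"
      using Suc.prems by simp
    then have "(D ^^ N) (\<Sum>i<Suc N. q i * module_basis i) = 0"
      by (rule funpow_derivation_eq_0_mono[OF D]) (use 3 in simp)
    then have "q N = 0"
      using top b(1) L1 by simp
    then show ?thesis
      using Suc by simp
  qed
qed

lemma image_ideal_eq:
  "image_ideal D n = principal_ideal (derivation_kernel D) (L 1 ^ image_exponent n)"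
proof (intro equalityI subsetI)
  fix y assume "y \<in> image_ideal D n"
  then obtain b where b: "y = (D ^^ n) b" "D y = 0"
    by (auto simp: image_ideal_def derivation_kernel_def)
  obtain q N where "\<And>i. D (q i) = 0" "b = (\<Sum>i<N. q i * module_basis i)"
    using module_span_eq_UNIV unfolding module_span_def by blast
  then show "y \<in> principal_ideal (derivation_kernel D) (L 1 ^ image_exponent n)"
    using funpow_derivation_in_principal_ideal[of q n N] b
    by (auto simp: principal_ideal_def derivation_kernel_def)
next
  fix y assume "y \<in> principal_ideal (derivation_kernel D) (L 1 ^ image_exponent n)"
  then obtain r where r: "D r = 0" "y = r * L 1 ^ image_exponent n"
    by (auto simp: principal_ideal_def derivation_kernel_def)
  obtain b where b: "b \<noteq> 0" "(D ^^ n) (module_basis n) = const b * L 1 ^ image_exponent n"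
    using leading_term_module_basis[of n] unfolding leading_term_def by blast
  \<comment> \<open>The preimage of \<open>y\<close> is \<open>r * module_basis n\<close>, rescaled
    by the inverse of the leading scalar \<open>b\<close>.\<close>
  have kernel: "D (r * const (inverse b)) = 0"
    by (simp add: derivation_mult[OF D] derivation_const[OF D] r(1))
  have "(D ^^ n) (r * const (inverse b) * module_basis n) = r * const (inverse b * b) * L 1 ^ image_exponent n"
    unfolding funpow_derivation_kernel_mult[OF D kernel] b(2) by (simp add: const_mult mult_ac)
  then have "y = (D ^^ n) (r * const (inverse b) * module_basis n)"
    using b(1) r(2) by simp
  moreover have "D y = 0"
    using r by (simp add: derivation_mult[OF D] derivation_power[OF D] D1)
  ultimately show "y \<in> image_ideal D n"
    by (auto simp: image_ideal_def derivation_kernel_def)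
qed

end

section \<open>Nonvanishing from irreducibility, and the image ideals\<close>

theorem theorem4p6:
  fixes D :: "'k::field_char_0 poly3 \<Rightarrow> 'k poly3" and d :: nat
  assumes "locally_nilpotent_derivation D"
    and "irreducible_derivation D"
    and "homogeneous_derivation D (int d)"
    and "triangularizable D"
  shows "\<exists>X. linear_variable X \<and> X \<in> derivation_kernel D \<and>
    (\<forall>n. image_ideal D n =
       principal_ideal (derivation_kernel D)
         (X ^ ((n div (d + 2)) * (d + 1)^2 + (n mod (d + 2)) * (d + 1))))"
proof -
  have D: "derivation D"
    using assms(1) by (simp add: locally_nilpotent_derivation_def)
  obtain L :: "3 \<Rightarrow> 'k poly3" and a c where L: "\<And>i. L i \<in> homogeneous_component 1" "adjoin (range L) = UNIV"
    and D1: "D (L 1) = 0" and D2: "D (L 2) = const a * L 1 ^ Suc d"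
    and D3: "D (L 3) = (\<Sum>i\<le>Suc d. const (c i) * L 1 ^ (Suc d - i) * L 2 ^ i)"
    by (rule triangularizable_linear_coordinates[OF D assms(3,4)]) blast
  have order: "L i \<in> order_ge 1" for i
    using homogeneous_in_order_ge[of "L i" 1] L(1) by simp
  have generator: "\<not> (p dvd D (L 1) \<and> p dvd D (L 2) \<and> p dvd D (L 3))" if "p \<in> order_ge 1" for p
    using irreducible_derivation_generator[OF D assms(2) L(2) that] exhaust_3 by metis
  have "D (L 3) \<in> order_ge (1 + d)"
    by (rule homogeneous_derivation_order_ge[OF D assms(3) order])
  \<comment> \<open>Otherwise \<open>D (L 3)\<close>, which has positive order, would itself divide
    all three derivatives; this covers \<open>D (L 3) = 0\<close> too.\<close>
  then have "D (L 2) \<noteq> 0"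
    using generator[of "D (L 3)"] D1 order_ge_mono by fastforce
  then have a: "a \<noteq> 0" and L1: "L 1 \<noteq> 0"
    by (auto simp: D2)
  have c: "c (Suc d) \<noteq> 0"
  proof
    assume 0: "c (Suc d) = 0"
    \<comment> \<open>Without the pure power of \<open>L 2\<close>, every term of
      \<open>D (L 3)\<close> contains \<open>L 1\<close>, which would then divide all three
      derivatives.\<close>
    have "L 1 dvd const (c i) * L 1 ^ (Suc d - i) * L 2 ^ i" if "i \<le> Suc d" for i
      using 0 that by (cases "i = Suc d") (auto intro!: dvd_mult dvd_mult2 dvd_power)
    then have "L 1 dvd D (L 3)"
      unfolding D3 by (intro dvd_sum) auto
    then show False
      using generator[OF order, of 1] D1 D2 by simp
  qed
  interpret linear_triangular_derivation D L "Suc d" a c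
    by unfold_locales (fact D L(2) D1 D2 D3 L1 a c)+
  show ?thesis
  proof (intro exI[of _ "L 1"] conjI allI)
    show "linear_variable (L 1)"
      using L(1) L1 by (simp add: linear_variable_def)
    show "L 1 \<in> derivation_kernel D"
      using D1 by (simp add: derivation_kernel_def)
    show "image_ideal D n = principal_ideal (derivation_kernel D)
        (L 1 ^ ((n div (d + 2)) * (d + 1)^2 + (n mod (d + 2)) * (d + 1)))" for n
      using image_ideal_eq[of n] by (simp add: image_exponent_def power2_eq_square)
  qed
qed

end
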